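(* Let $\mathcal{H}$ be a real Hilbert space, let $A_1,A_2:\mathcal{H}\to2^{\mathcal{H}}$ be maximally monotone operators, and let $B_1,B_2:\mathcal{H}\to\mathcal{H}$ be $\alpha_1$-cocoercive and $\alpha_2$-cocoercive operators, respectively ($\alpha_1,\alpha_2>0$). Suppose $\operatorname{Zer}(A_1+B_1)\cap\operatorname{Zer}(A_2+B_2)\neq\emptyset$, $\gamma_1\in(0,2\alpha_1)$ and $\gamma_2\in(0,2\alpha_2)$. For $y_1\in\mathcal{H}$, let $$y_{n+1}=J_{\gamma_2A_2}(\mathrm{Id}-\gamma_2B_2)\left\{(1-\theta_n)e_ny_n+\theta_nJ_{\gamma_1A_1}\big(e_ny_n-\gamma_1B_1(e_ny_n)\big)\right\}\qquad\text{for all } n\in\mathbb{N},$$ where $\{\theta_n\}$ and $\{e_n\}$ are real sequences such that $0<e_n<1$ for all $n\in\mathbb{N}$, $\lim_{n\to\infty}e_n=1$, $\sum_{n=1}^{\infty}(1-e_n)=\infty$, $\sum_{n=2}^{\infty}|e_n-e_{n-1}|<\infty$, and there are constants $\underline{\Theta},\overline{\Theta}$ with $$0<\underline{\Theta}\le\frac{2\alpha_1}{4\alpha_1-\gamma_1}\theta_n\le\overline{\Theta}<1\ \text{ for all } n\in\mathbb{N},\qquad\sum_{n=2}^{\infty}|\theta_n-\theta_{n-1}|<\infty.$$ Then $\{y_n\}$ converges strongly to $\operatorname{proj}_{\operatorname{Zer}(A_1+B_1)\cap\operatorname{Zer}(A_2+B_2)}(0)$.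
   Context: $\mathbb{N}=\{1,2,\dots\}$. A set-valued operator $A:\mathcal{H}\to2^{\mathcal{H}}$ is monotone if $\langle x-y,u-v\rangle\ge0$ for all $(x,u),(y,v)$ in its graph, and maximally monotone if no monotone operator has a graph properly containing its graph. $B:\mathcal{H}\to\mathcal{H}$ is $\beta$-cocoercive ($\beta>0$) if $\langle x-y,Bx-By\rangle\ge\beta\|Bx-By\|^2$ for all $x,y$. $J_A=(\mathrm{Id}+A)^{-1}$ is the resolvent of $A$. $\operatorname{Zer}(T)=\{x: 0\in Tx\}$. $\operatorname{proj}_C$ is the metric projection onto a nonempty closed convex set $C$. Strong convergence means convergence in norm. *)

theory Defs
  imports "HOL-Analysis.Analysis"
begin

text \<open>A real Hilbert space is a type of sort \<open>{real_inner, complete_space}\<close>, and a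
  set-valued operator on it is a function of type \<open>'a \<Rightarrow> 'a set\<close>.\<close>

definition op_graph :: "('a \<Rightarrow> 'a set) \<Rightarrow> ('a \<times> 'a) set" where
  "op_graph A = {(x, u). u \<in> A x}"

definition monotone_operator :: "('a::real_inner \<Rightarrow> 'a set) \<Rightarrow> bool" where
  "monotone_operator A \<longleftrightarrow>
     (\<forall>(x, u) \<in> op_graph A. \<forall>(y, v) \<in> op_graph A. inner (x - y) (u - v) \<ge> 0)"

definition maximally_monotone :: "('a::real_inner \<Rightarrow> 'a set) \<Rightarrow> bool" where
  "maximally_monotone A \<longleftrightarrow>
     monotone_operator A \<and> \<not> (\<exists>A'. monotone_operator A' \<and> op_graph A \<subset> op_graph A')"

text \<open>The side condition \<open>\<beta> > 0\<close> is not part of the definition.\<close>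

definition cocoercive :: "real \<Rightarrow> ('a::real_inner \<Rightarrow> 'a) \<Rightarrow> bool" where
  "cocoercive \<beta> B \<longleftrightarrow> (\<forall>x y. inner (x - y) (B x - B y) \<ge> \<beta> * (norm (B x - B y))\<^sup>2)"

definition op_single :: "('a \<Rightarrow> 'a) \<Rightarrow> 'a \<Rightarrow> 'a set" where
  "op_single B = (\<lambda>x. {B x})"

definition op_add :: "('a::real_vector \<Rightarrow> 'a set) \<Rightarrow> ('a \<Rightarrow> 'a set) \<Rightarrow> 'a \<Rightarrow> 'a set" where
  "op_add A B = (\<lambda>x. {u + v | u v. u \<in> A x \<and> v \<in> B x})"

definition op_scale :: "real \<Rightarrow> ('a::real_vector \<Rightarrow> 'a set) \<Rightarrow> 'a \<Rightarrow> 'a set" where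
  "op_scale c A = (\<lambda>x. {c *\<^sub>R u | u. u \<in> A x})"

definition op_inverse :: "('a \<Rightarrow> 'a set) \<Rightarrow> 'a \<Rightarrow> 'a set" where
  "op_inverse A = (\<lambda>u. {x. u \<in> A x})"

definition Zer :: "('a::real_vector \<Rightarrow> 'a set) \<Rightarrow> 'a set" where
  "Zer T = {x. 0 \<in> T x}"

text \<open>For a maximally monotone \<open>A\<close> on a Hilbert space, \<open>(Id + A)\<inverse>\<close> is single-valued with
  full domain (Minty), so the description below denotes its unique value at \<open>x\<close>.
  For other \<open>A\<close> the value may be unspecified.\<close>

definition resolvent :: "('a::real_vector \<Rightarrow> 'a set) \<Rightarrow> 'a \<Rightarrow> 'a" where
  "resolvent A = (\<lambda>x. THE p. p \<in> op_inverse (op_add (op_single id) A) x)"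

text \<open>The library's \<^const>\<open>closest_point\<close> is restricted to \<open>heine_borel\<close> spaces, that is, to finite
  dimension.  The description below is well defined when \<open>C\<close> is a nonempty closed convex subset
  of a Hilbert space.\<close>

definition metric_proj :: "'a::real_inner set \<Rightarrow> 'a \<Rightarrow> 'a" where
  "metric_proj C x = (THE p. p \<in> C \<and> (\<forall>q\<in>C. dist x p \<le> dist x q))"

end

theory Submission
  imports Defs
begin

text \<open>With \<open>S\<^sub>i = I - J\<^bsub>\<gamma>\<^sub>iA\<^sub>i\<^esub>(I - \<gamma>\<^sub>iB\<^sub>i)\<close> the iteration reads
  \<open>y' = (I - S\<^sub>2)(I - \<theta>S\<^sub>1)(e y)\<close>, where \<open>S\<^sub>i\<close> is cocoercive with constant
  \<open>1 - \<gamma>\<^sub>i / (4\<alpha>\<^sub>i) > 1/2\<close> and the target set consists of the common zeros of \<open>S\<^sub>1\<close> and \<open>S\<^sub>2\<close>.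
  The increments of \<open>y\<close> satisfy a contractive recursion with summable errors and so vanish;
  strict decrease of the distance to a common zero then forces \<open>S\<^sub>1(e y)\<close> and \<open>S\<^sub>2(e y)\<close> to \<open>0\<close>.
  Comparing with Browder's path, which converges to the common zero \<open>q\<close> of minimal norm, gives
  \<open>liminf \<langle>q, e y - q\<rangle> \<ge> 0\<close>, and a second contractive recursion, for the squared distance of
  \<open>y\<close> to \<open>q\<close>, yields the claim.\<close>

section \<open>Minty's theorem\<close>

lemma monotone_operator_iff:
  "monotone_operator A \<longleftrightarrow>
     (\<forall>x y u v. u \<in> A x \<longrightarrow> v \<in> A y \<longrightarrow> inner (x - y) (u - v) \<ge> 0)"
  by (auto simp: monotone_operator_def op_graph_def)

lemma monotone_operatorD:
  "monotone_operator A \<Longrightarrow> u \<in> A x \<Longrightarrow> v \<in> A y \<Longrightarrow> inner (x - y) (u - v) \<ge> 0"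
  by (simp add: monotone_operator_iff)

text \<open>A pair monotonically related to the whole graph can be adjoined to it by a one-point
  update of \<open>A\<close>, so maximality forces it to be there already. This pointwise form
  replaces quantification over competing operators from here on.\<close>

lemma maximally_monotone_iff:
  "maximally_monotone A \<longleftrightarrow> monotone_operator A \<and>
     (\<forall>p v. (\<forall>a u. u \<in> A a \<longrightarrow> inner (p - a) (v - u) \<ge> 0) \<longrightarrow> v \<in> A p)"
  (is "_ \<longleftrightarrow> _ \<and> ?max")
proof (intro iffI conjI)
  assume max: "maximally_monotone A"
  then show mono: "monotone_operator A" by (simp add: maximally_monotone_def)
  show ?max
  proof (intro allI impI)
    fix p v assume pv: "\<forall>a u. u \<in> A a \<longrightarrow> inner (p - a) (v - u) \<ge> 0"
    define A' where "A' = A(p := insert v (A p))"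
    have gr: "op_graph A' = insert (p, v) (op_graph A)"
      by (auto simp: op_graph_def A'_def split: if_splits)
    have flip: "inner (a - p) (u - v) = inner (p - a) (v - u)" for a u
      by (simp add: inner_diff_left inner_diff_right)
    have "monotone_operator A'"
      unfolding monotone_operator_def gr
      using mono pv by (auto simp: monotone_operator_def op_graph_def flip)
    with max have "\<not> op_graph A \<subset> op_graph A'"
      by (auto simp: maximally_monotone_def)
    with gr show "v \<in> A p" by (auto simp: op_graph_def)
  qed
next
  assume "monotone_operator A \<and> ?max"
  then have mono: "monotone_operator A" and max: ?max by auto
  have "op_graph A' \<subseteq> op_graph A" if "monotone_operator A'" "op_graph A \<subseteq> op_graph A'" for A'
  proof clarify
    fix p v assume "(p, v) \<in> op_graph A'"
    with that have "\<forall>a u. u \<in> A a \<longrightarrow> inner (p - a) (v - u) \<ge> 0"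
      by (fastforce simp: monotone_operator_def op_graph_def)
    with max show "(p, v) \<in> op_graph A" by (auto simp: op_graph_def)
  qed
  with mono show "maximally_monotone A"
    unfolding maximally_monotone_def by blast
qed

lemma inner_le_on_hull_of_monotone:
  fixes G :: "('a::real_inner \<times> 'a) set"
  assumes mono: "\<And>a u b v. (a, u) \<in> G \<Longrightarrow> (b, v) \<in> G \<Longrightarrow> inner (a - b) (u - v) \<ge> 0"
    and H: "(a, u, s) \<in> convex hull ((\<lambda>(a, u). (a, u, inner a u)) ` G)"
  shows "inner a u \<le> s"
proof -
  \<comment> \<open>The polarised inequality is affine in each of the two points separately, so it
    passes to the hull one point at a time; the claim is its diagonal.\<close>
  let ?E = "(\<lambda>(a, u). (a, u, inner a u)) ` G"
  \<comment> \<open>On two lifted graph points \<open>P\<close> equals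
    \<open>inner (a - b) (u - v)\<close>; the third coordinates stand in for the quadratic terms
    \<open>inner a u\<close> and \<open>inner b v\<close>.\<close>
  define P :: "'a \<times> 'a \<times> real \<Rightarrow> 'a \<times> 'a \<times> real \<Rightarrow> real" where
    "P = (\<lambda>(a, u, s) (b, v, t). s + t - inner a v - inner b u)"
  have sym: "P z w = P w z" for z w by (auto simp: P_def split: prod.splits)
  have convex: "convex {w. P z w \<ge> 0}" for z
  proof (rule convexI)
    fix w w' :: "'a \<times> 'a \<times> real" and k l :: real
    assume *: "w \<in> {w. P z w \<ge> 0}" "w' \<in> {w. P z w \<ge> 0}" "0 \<le> k" "0 \<le> l" "k + l = 1"
    have l: "l = 1 - k" using * by simp
    have "P z (k *\<^sub>R w + l *\<^sub>R w') = k * P z w + l * P z w'"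
      unfolding l by (auto simp: P_def inner_simps algebra_simps split: prod.splits)
    with * show "k *\<^sub>R w + l *\<^sub>R w' \<in> {w. P z w \<ge> 0}" by simp
  qed
  have base: "P z w \<ge> 0" if "z \<in> ?E" "w \<in> ?E" for z w
    using that mono by (fastforce simp: P_def inner_simps algebra_simps inner_commute)
  have one: "P z w \<ge> 0" if "z \<in> ?E" "w \<in> convex hull ?E" for z w
    using hull_minimal[of ?E "{w. P z w \<ge> 0}" convex] base that convex by blast
  have "P z w \<ge> 0" if "z \<in> convex hull ?E" "w \<in> convex hull ?E" for z w
    using hull_minimal[of ?E "{w. P z w \<ge> 0}" convex] one that convex sym
    by (metis (no_types, lifting) mem_Collect_eq subset_iff)
  from this[OF H H] show ?thesis by (simp add: P_def)
qed

text \<open>The inequalities say that closed balls with centres \<open>(a - u) / 2\<close> have a common point.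
  That point is found as the limit of the centres along a maximising sequence of the dual
  problem, which is a concave problem on the convex hull.\<close>

lemma monotone_extension_point:
  fixes G :: "('a::{real_inner, complete_space} \<times> 'a) set"
  assumes mono: "\<And>a u b v. (a, u) \<in> G \<Longrightarrow> (b, v) \<in> G \<Longrightarrow> inner (a - b) (u - v) \<ge> 0"
  shows "\<exists>p. \<forall>(a, u) \<in> G. inner (p - a) (- p - u) \<ge> 0"
proof (cases "G = {}")
  case False
  define H where "H = convex hull ((\<lambda>(a, u). (a, u, inner a u)) ` G)"
  define c :: "'a \<times> 'a \<times> real \<Rightarrow> 'a" where "c = (\<lambda>(a, u, s). (1/2) *\<^sub>R (a - u))"
  \<comment> \<open>For fixed \<open>p\<close>, \<open>f z + (norm (p - c z))\<^sup>2\<close> is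
    affine in \<open>z\<close>, and at a lifted graph point its being nonpositive is the inequality
    wanted of \<open>p\<close>. Its minimum over \<open>p\<close> is \<open>f z\<close>, which is
    therefore the dual objective.\<close>
  define f :: "'a \<times> 'a \<times> real \<Rightarrow> real" where "f = (\<lambda>(a, u, s). - s - (norm (c (a, u, s)))\<^sup>2)"
  have ne: "f ` H \<noteq> {}" using False by (simp add: H_def)
  \<comment> \<open>\<open>f z\<close> is \<open>inner a u - s\<close> minus the squared norm of
    \<open>(a + u) / 2\<close>, and the hull inequality makes the first difference
    nonpositive.\<close>
  have f_le: "f z \<le> 0" if zH: "z \<in> H" for z
  proof -
    obtain a u s where z: "z = (a, u, s)" by (cases z)
    have "inner a u \<le> s"
      using inner_le_on_hull_of_monotone[OF mono] zH unfolding H_def z by blast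
    moreover have "(norm (c z))\<^sup>2 + inner a u = (norm ((1/2) *\<^sub>R (a + u)))\<^sup>2"
      unfolding z c_def power2_norm_eq_inner by (simp add: inner_simps inner_commute field_simps)
    ultimately show ?thesis by (simp add: f_def z) (smt (verit) zero_le_power2)
  qed
  then have bdd: "bdd_above (f ` H)" by (intro bdd_aboveI2)
  define S where "S = Sup (f ` H)"
  have f_S: "f z \<le> S" if "z \<in> H" for z
    unfolding S_def using bdd that by (simp add: cSup_upper)
  have "S \<le> 0" unfolding S_def using ne f_le by (intro cSup_least) auto
  \<comment> \<open>The third coordinate enters linearly, so the concavity defect of
    \<open>f\<close> is exactly that of the squared norm of the centre.\<close>
  have comb: "f ((1 - t) *\<^sub>R z + t *\<^sub>R w) = (1 - t) * f z + t * f w + t * (1 - t) * (norm (c z - c w))\<^sup>2"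
    for t z w
  proof -
    have c: "c ((1 - t) *\<^sub>R z + t *\<^sub>R w) = (1 - t) *\<^sub>R c z + t *\<^sub>R c w"
      by (cases z; cases w) (simp add: c_def scaleR_right_diff_distrib scaleR_right_distrib)
    have f: "f z = - snd (snd z) - (norm (c z))\<^sup>2" for z
      by (simp add: f_def split: prod.split)
    have "(norm ((1 - t) *\<^sub>R a + t *\<^sub>R b))\<^sup>2
        = (1 - t) * (norm a)\<^sup>2 + t * (norm b)\<^sup>2 - t * (1 - t) * (norm (a - b))\<^sup>2" for a b :: 'a
      unfolding power2_norm_eq_inner by (simp add: inner_diff_left inner_diff_right
          inner_add_left inner_add_right inner_commute algebra_simps)
    then show ?thesis unfolding f c by (simp add: algebra_simps)
  qed
  have step: "(1 - t) * f z + t * f w + t * (1 - t) * (norm (c z - c w))\<^sup>2 \<le> S"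
    if "z \<in> H" "w \<in> H" "0 \<le> t" "t \<le> 1" for t z w
  proof -
    have "(1 - t) *\<^sub>R z + t *\<^sub>R w \<in> H"
      using convexD_alt[OF convex_convex_hull] that unfolding H_def by blast
    from f_S[OF this] show ?thesis by (simp add: comb)
  qed
  have "\<exists>z\<in>H. f z > S - 1 / real (Suc n)" for n
    using less_cSupD[OF ne, of "S - 1 / real (Suc n)"] unfolding S_def by auto
  then obtain z where zH: "\<And>n. z n \<in> H" and fz: "\<And>n. f (z n) > S - 1 / real (Suc n)"
    by metis
  have fz_lim: "(\<lambda>n. f (z n)) \<longlonglongrightarrow> S"
  proof (rule tendsto_sandwich)
    show "(\<lambda>n. S - 1 / real (Suc n)) \<longlonglongrightarrow> S"
      using tendsto_diff[OF tendsto_const LIMSEQ_inverse_real_of_nat, of S] by (simp add: inverse_eq_divide)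
    show "(\<lambda>n. S) \<longlonglongrightarrow> S" by simp
  qed (use fz f_S zH in \<open>auto intro!: always_eventually less_imp_le\<close>)
  \<comment> \<open>The midpoint of two near-maximisers has value at most \<open>S\<close>, so the
    defect, a quarter of the squared distance of the centres, is at most
    \<open>1 / real (Suc k)\<close>. Only the centres need converge, not the points
    \<open>z n\<close>.\<close>
  have dist: "(norm (c (z m) - c (z n)))\<^sup>2 \<le> 4 / real (Suc k)" if "m \<ge> k" "n \<ge> k" for m n k
  proof -
    have "1 / real (Suc m) \<le> 1 / real (Suc k)" "1 / real (Suc n) \<le> 1 / real (Suc k)"
      using that by (auto intro!: divide_left_mono)
    then have "f (z m) \<ge> S - 1 / real (Suc k)" "f (z n) \<ge> S - 1 / real (Suc k)"
      using fz[of m] fz[of n] by linarith+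
    then show ?thesis using step[OF zH zH, of "1/2" m n] by simp
  qed
  have "Cauchy (\<lambda>n. c (z n))"
  proof (rule metric_CauchyI)
    fix \<epsilon> :: real assume "\<epsilon> > 0"
    then obtain k where k: "inverse (real (Suc k)) < \<epsilon>\<^sup>2 / 4"
      using reals_Archimedean[of "\<epsilon>\<^sup>2 / 4"] by auto
    have "dist (c (z m)) (c (z n)) < \<epsilon>" if "m \<ge> k" "n \<ge> k" for m n
    proof -
      have "(dist (c (z m)) (c (z n)))\<^sup>2 < \<epsilon>\<^sup>2"
        using dist[OF that] k by (simp add: dist_norm inverse_eq_divide)
      then show ?thesis using \<open>\<epsilon> > 0\<close> by (simp add: power_less_imp_less_base)
    qed
    then show "\<exists>k. \<forall>m\<ge>k. \<forall>n\<ge>k. dist (c (z m)) (c (z n)) < \<epsilon>" by blast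
  qed
  then obtain p where p: "(\<lambda>n. c (z n)) \<longlonglongrightarrow> p"
    using Cauchy_convergent convergent_def by blast
  \<comment> \<open>First-order optimality in the limit: move from \<open>z n\<close> towards
    \<open>w\<close> by a fraction \<open>t\<close>, let \<open>n\<close> tend to infinity, divide
    by \<open>t\<close>, and then let \<open>t\<close> tend to 0.\<close>
  have key: "f w + (norm (p - c w))\<^sup>2 \<le> S" if "w \<in> H" for w
  proof -
    have "f w + (1 - t) * (norm (p - c w))\<^sup>2 \<le> S" if "0 < t" "t \<le> 1" for t
    proof -
      have "(1 - t) * S + t * f w + t * (1 - t) * (norm (p - c w))\<^sup>2 \<le> S"
        by (rule LIMSEQ_le_const2[of "\<lambda>n. (1 - t) * f (z n) + t * f w + t * (1 - t) * (norm (c (z n) - c w))\<^sup>2"])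
          (use that \<open>w \<in> H\<close> zH in \<open>auto intro!: tendsto_intros fz_lim p step\<close>)
      then have "t * (f w + (1 - t) * (norm (p - c w))\<^sup>2) \<le> t * S" by (simp add: algebra_simps)
      with \<open>0 < t\<close> show ?thesis by simp
    qed
    then have "f w + (1 - 1 / real (Suc n)) * (norm (p - c w))\<^sup>2 \<le> S" for n
      by simp
    moreover have "(\<lambda>n. f w + (1 - 1 / real (Suc n)) * (norm (p - c w))\<^sup>2) \<longlonglongrightarrow> f w + (1 - 0) * (norm (p - c w))\<^sup>2"
      using LIMSEQ_inverse_real_of_nat by (intro tendsto_intros) (simp add: inverse_eq_divide)
    ultimately show ?thesis by (intro LIMSEQ_le_const2) auto
  qed
  have "inner (p - a) (- p - u) \<ge> 0" if "(a, u) \<in> G" for a u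
  proof -
    have "(a, u, inner a u) \<in> H"
      unfolding H_def using that by (intro hull_inc image_eqI[of _ _ "(a, u)"]) auto
    from key[OF this] \<open>S \<le> 0\<close> show ?thesis
      by (simp add: f_def c_def power2_norm_eq_inner inner_simps inner_commute field_simps)
  qed
  then show ?thesis by auto
qed simp

text \<open>Shifting all values of \<open>A\<close> by \<open>- x\<close> turns the extension
  inequality into the statement that \<open>x - p\<close> is monotonically related to
  \<open>A\<close> at \<open>p\<close>; maximality does the rest.\<close>

lemma minty:
  fixes A :: "'a::{real_inner, complete_space} \<Rightarrow> 'a set"
  assumes "maximally_monotone A"
  shows "\<exists>p. x - p \<in> A p"
proof -
  have "\<exists>p. \<forall>(a, w) \<in> {(a, u - x) | a u. u \<in> A a}. inner (p - a) (- p - w) \<ge> 0"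
  proof (rule monotone_extension_point)
    fix a u b v
    assume "(a, u) \<in> {(a, u - x) | a u. u \<in> A a}" "(b, v) \<in> {(a, u - x) | a u. u \<in> A a}"
    then obtain u' v' where "u = u' - x" "v = v' - x" "u' \<in> A a" "v' \<in> A b" by blast
    with assms monotone_operatorD[of A u' a v' b] show "inner (a - b) (u - v) \<ge> 0"
      by (simp add: maximally_monotone_def)
  qed
  then obtain p where p: "\<And>a u. u \<in> A a \<Longrightarrow> inner (p - a) (- p - (u - x)) \<ge> 0" by blast
  have "inner (p - a) (x - p - u) \<ge> 0" if "u \<in> A a" for a u
    using p[OF that] by (simp add: algebra_simps)
  with assms show ?thesis unfolding maximally_monotone_iff by blast
qed

text \<open>Existence comes from \<open>minty\<close>, uniqueness from monotonicity. Later arguments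
  use this inclusion instead of the definite description.\<close>

lemma resolvent_eq_iff:
  fixes A :: "'a::{real_inner, complete_space} \<Rightarrow> 'a set"
  assumes A: "maximally_monotone A"
  shows "resolvent A x = p \<longleftrightarrow> x - p \<in> A p"
proof -
  have mem: "p \<in> op_inverse (op_add (op_single id) A) x \<longleftrightarrow> x - p \<in> A p" for p
    by (auto simp: op_inverse_def op_add_def op_single_def intro!: exI[of _ "x - p"])
  have uniq: "p = q" if "x - p \<in> A p" "x - q \<in> A q" for p q
  proof -
    have "inner (p - q) ((x - p) - (x - q)) \<ge> 0"
      using A that by (intro monotone_operatorD) (auto simp: maximally_monotone_def)
    then have "inner (p - q) (p - q) \<le> 0" by (simp add: inner_simps inner_commute)
    then show ?thesis using inner_ge_zero[of "p - q"] by (metis inner_eq_zero_iff order_antisym right_minus_eq)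
  qed
  obtain q where q: "x - q \<in> A q" using minty[OF A] by blast
  have "resolvent A x = q" unfolding resolvent_def mem
    using q uniq by (intro the_equality) auto
  with q uniq show ?thesis by blast
qed

lemma maximally_monotone_op_scale:
  assumes "maximally_monotone A" "c > 0"
  shows "maximally_monotone (op_scale c A)"
  unfolding maximally_monotone_iff
proof (intro conjI allI impI)
  show "monotone_operator (op_scale c A)"
    unfolding monotone_operator_iff
  proof (intro allI impI)
    fix x y u v assume "u \<in> op_scale c A x" "v \<in> op_scale c A y"
    then obtain u' v' where uv: "u = c *\<^sub>R u'" "v = c *\<^sub>R v'" "u' \<in> A x" "v' \<in> A y"
      by (auto simp: op_scale_def)
    with assms(1) have "inner (x - y) (u' - v') \<ge> 0"
      by (intro monotone_operatorD) (auto simp: maximally_monotone_def)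
    moreover have "inner (x - y) (u - v) = c * inner (x - y) (u' - v')"
      by (simp add: uv flip: scaleR_diff_right)
    ultimately show "inner (x - y) (u - v) \<ge> 0" using assms(2) by simp
  qed
  fix p v assume *: "\<forall>a u. u \<in> op_scale c A a \<longrightarrow> inner (p - a) (v - u) \<ge> 0"
  have "inner (p - a) (v /\<^sub>R c - u) \<ge> 0" if "u \<in> A a" for a u
  proof -
    have "inner (p - a) (v - c *\<^sub>R u) \<ge> 0" using * that by (auto simp: op_scale_def)
    also have "v - c *\<^sub>R u = c *\<^sub>R (v /\<^sub>R c - u)" using assms(2) by (simp add: scaleR_diff_right)
    finally show ?thesis using assms(2) by (simp add: zero_le_mult_iff)
  qed
  then have "v /\<^sub>R c \<in> A p" using assms(1) by (auto simp: maximally_monotone_iff)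
  then show "v \<in> op_scale c A p"
    using assms(2) by (auto simp: op_scale_def intro!: exI[of _ "v /\<^sub>R c"])
qed

section \<open>The forward-backward operator\<close>

definition forward_backward ::
    "real \<Rightarrow> ('a::real_vector \<Rightarrow> 'a set) \<Rightarrow> ('a \<Rightarrow> 'a) \<Rightarrow> 'a \<Rightarrow> 'a" where
  "forward_backward \<gamma> A B x = resolvent (op_scale \<gamma> A) (x - \<gamma> *\<^sub>R B x)"

lemma forward_backward_fixed_iff:
  fixes A :: "'a::{real_inner, complete_space} \<Rightarrow> 'a set"
  assumes "maximally_monotone A" "\<gamma> > 0"
  shows "forward_backward \<gamma> A B x = x \<longleftrightarrow> x \<in> Zer (op_add A (op_single B))"
proof -
  have "forward_backward \<gamma> A B x = x \<longleftrightarrow> - \<gamma> *\<^sub>R B x \<in> op_scale \<gamma> A x"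
    unfolding forward_backward_def resolvent_eq_iff[OF maximally_monotone_op_scale[OF assms]] by simp
  also have "\<dots> \<longleftrightarrow> - B x \<in> A x"
    using assms(2) by (auto simp: op_scale_def simp flip: scaleR_minus_right)
  also have "\<dots> \<longleftrightarrow> x \<in> Zer (op_add A (op_single B))"
    by (auto simp: Zer_def op_add_def op_single_def eq_neg_iff_add_eq_0 eq_commute[of 0]
        intro!: exI[of _ "- B x"] dest: eq_neg_iff_add_eq_0[THEN iffD2])
  finally show ?thesis .
qed

text \<open>Monotonicity of the scaled operator at the two resolvent values gives
  \<open>inner (d - w) (w - \<gamma> *\<^sub>R b) \<ge> 0\<close>. Cocoercivity of \<open>B\<close>
  supplies a square of \<open>b\<close> with which the mixed term in \<open>w\<close> and
  \<open>b\<close> is absorbed.\<close>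

lemma forward_backward_cocoercive:
  fixes A :: "'a::{real_inner, complete_space} \<Rightarrow> 'a set"
  assumes A: "maximally_monotone A" and B: "cocoercive \<alpha> B" and "\<alpha> > 0" "\<gamma> > 0"
  shows "cocoercive (1 - \<gamma> / (4 * \<alpha>)) (\<lambda>x. x - forward_backward \<gamma> A B x)"
  unfolding cocoercive_def
proof (intro allI)
  fix x y
  let ?T = "forward_backward \<gamma> A B"
  define d b w where "d = x - y" and "b = B x - B y" and "w = (x - ?T x) - (y - ?T y)"
  note max = maximally_monotone_op_scale[OF A \<open>\<gamma> > 0\<close>]
  have mem: "x - \<gamma> *\<^sub>R B x - ?T x \<in> op_scale \<gamma> A (?T x)" for x
    using resolvent_eq_iff[OF max] unfolding forward_backward_def by blast
  have "inner (?T x - ?T y) ((x - \<gamma> *\<^sub>R B x - ?T x) - (y - \<gamma> *\<^sub>R B y - ?T y)) \<ge> 0"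
    using max mem by (intro monotone_operatorD) (auto simp: maximally_monotone_def)
  also have "?T x - ?T y = d - w" by (simp add: d_def w_def)
  also have "(x - \<gamma> *\<^sub>R B x - ?T x) - (y - \<gamma> *\<^sub>R B y - ?T y) = w - \<gamma> *\<^sub>R b"
    by (simp add: w_def b_def algebra_simps)
  finally have 1: "inner d w \<ge> inner w w + \<gamma> * inner d b - \<gamma> * inner w b"
    by (simp add: inner_simps inner_commute algebra_simps)
  have 2: "\<gamma> * inner d b \<ge> \<gamma> * (\<alpha> * inner b b)"
    using B \<open>\<gamma> > 0\<close> by (simp add: cocoercive_def d_def b_def power2_norm_eq_inner)
  \<comment> \<open>Completing the square in \<open>b\<close>; the shift by \<open>w\<close> over
    \<open>2 * \<alpha>\<close> costs the term \<open>\<gamma> / (4 * \<alpha>)\<close> in the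
    constant.\<close>
  have "0 \<le> \<gamma> * \<alpha> * inner (b - (1 / (2 * \<alpha>)) *\<^sub>R w) (b - (1 / (2 * \<alpha>)) *\<^sub>R w)"
    using \<open>\<alpha> > 0\<close> \<open>\<gamma> > 0\<close> by simp
  also have "\<dots> = \<gamma> * (\<alpha> * inner b b) - \<gamma> * inner w b + \<gamma> / (4 * \<alpha>) * inner w w"
    using \<open>\<alpha> > 0\<close> by (simp add: inner_simps inner_commute field_simps)
  finally have "(1 - \<gamma> / (4 * \<alpha>)) * inner w w \<le> inner d w"
    using 1 2 by (simp add: algebra_simps)
  then show "(1 - \<gamma> / (4 * \<alpha>)) * (norm ((x - ?T x) - (y - ?T y)))\<^sup>2
      \<le> inner (x - y) ((x - ?T x) - (y - ?T y))"
    by (simp add: d_def w_def power2_norm_eq_inner)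
qed

section \<open>Cocoercive operators\<close>

lemma cocoercive_lipschitz:
  assumes "cocoercive \<kappa> S" "\<kappa> > 0"
  shows "norm (S x - S y) \<le> norm (x - y) / \<kappa>"
proof (cases "S x = S y")
  case False
  have "\<kappa> * (norm (S x - S y))\<^sup>2 \<le> norm (x - y) * norm (S x - S y)"
    using assms norm_cauchy_schwarz order_trans unfolding cocoercive_def by blast
  then have "\<kappa> * norm (S x - S y) * norm (S x - S y) \<le> norm (x - y) * norm (S x - S y)"
    by (simp add: power2_eq_square mult.assoc)
  with False assms(2) show ?thesis by (simp add: field_simps)
qed (use assms in simp)

text \<open>Expand the square and bound the cross term by cocoercivity. The subtracted term later
  forces the residuals to vanish; the step length 1 makes it nonnegative as soon as
  \<open>\<kappa> \<ge> 1/2\<close>.\<close>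

lemma cocoercive_step:
  assumes "cocoercive \<kappa> S" "\<theta> \<ge> 0"
  shows "(norm ((x - \<theta> *\<^sub>R S x) - (y - \<theta> *\<^sub>R S y)))\<^sup>2
           \<le> (norm (x - y))\<^sup>2 - \<theta> * (2 * \<kappa> - \<theta>) * (norm (S x - S y))\<^sup>2"
proof -
  define d w where "d = x - y" and "w = S x - S y"
  have "\<theta> * (\<kappa> * inner w w) \<le> \<theta> * inner d w"
    using assms by (intro mult_left_mono) (auto simp: cocoercive_def d_def w_def power2_norm_eq_inner)
  then have "inner (d - \<theta> *\<^sub>R w) (d - \<theta> *\<^sub>R w) \<le> inner d d - \<theta> * (2 * \<kappa> - \<theta>) * inner w w"
    by (simp add: inner_simps inner_commute algebra_simps)
  moreover have "(x - \<theta> *\<^sub>R S x) - (y - \<theta> *\<^sub>R S y) = d - \<theta> *\<^sub>R w"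
    by (simp add: d_def w_def scaleR_diff_right)
  ultimately show ?thesis by (simp only: power2_norm_eq_inner d_def w_def)
qed

lemma cocoercive_step_nonexpansive:
  assumes "cocoercive \<kappa> S" "\<theta> \<ge> 0" "\<theta> \<le> 2 * \<kappa>"
  shows "norm ((x - \<theta> *\<^sub>R S x) - (y - \<theta> *\<^sub>R S y)) \<le> norm (x - y)"
proof (rule power2_le_imp_le)
  have "\<theta> * (2 * \<kappa> - \<theta>) * (norm (S x - S y))\<^sup>2 \<ge> 0" using assms by simp
  with cocoercive_step[OF assms(1,2), of x y]
  show "(norm ((x - \<theta> *\<^sub>R S x) - (y - \<theta> *\<^sub>R S y)))\<^sup>2 \<le> (norm (x - y))\<^sup>2" by linarith
qed simp

text \<open>Pairing \<open>S1 x + S2 x = 0\<close> with \<open>x - z\<close> gives two nonnegative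
  terms with sum zero. Common zeros thereby become the zeros of one operator.\<close>

lemma cocoercive_sum_zero:
  assumes "cocoercive \<kappa>1 S1" "cocoercive \<kappa>2 S2" "\<kappa>1 > 0" "\<kappa>2 > 0"
    and z: "S1 z = 0" "S2 z = 0" and x: "S1 x + S2 x = 0"
  shows "S1 x = 0 \<and> S2 x = 0"
proof -
  have "inner (x - z) (S1 x) \<ge> \<kappa>1 * (norm (S1 x))\<^sup>2" "inner (x - z) (S2 x) \<ge> \<kappa>2 * (norm (S2 x))\<^sup>2"
    using assms(1,2) z unfolding cocoercive_def by (metis diff_zero)+
  moreover have "inner (x - z) (S1 x) + inner (x - z) (S2 x) = 0"
    using x by (simp flip: inner_add_right)
  moreover have "\<kappa>1 * (norm (S1 x))\<^sup>2 \<ge> 0" "\<kappa>2 * (norm (S2 x))\<^sup>2 \<ge> 0" using assms(3,4) by auto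
  ultimately have "\<kappa>1 * (norm (S1 x))\<^sup>2 = 0" "\<kappa>2 * (norm (S2 x))\<^sup>2 = 0" by linarith+
  with assms(3,4) show ?thesis by simp
qed

section \<open>Browder's approximating path\<close>

lemma nonexpansive_displacement_monotone:
  fixes V :: "'a::real_inner \<Rightarrow> 'a"
  assumes "norm (V x - V y) \<le> norm (x - y)"
  shows "inner (x - y) ((x - V x) - (y - V y)) \<ge> 0"
proof -
  have "inner (x - y) (V x - V y) \<le> norm (x - y) * norm (x - y)"
    using norm_cauchy_schwarz[of "x - y" "V x - V y"] assms
    by (meson mult_left_mono norm_ge_zero order_trans)
  also have "\<dots> = inner (x - y) (x - y)" by (simp add: power2_norm_eq_inner flip: power2_eq_square)
  finally show ?thesis by (simp add: inner_diff_left inner_diff_right)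
qed

text \<open>The norms along the path increase, and the squared distance of two of its points is at
  most the difference of their squared norms. This gives strong convergence without weak
  compactness, and it also yields the minimum-norm fixed point.\<close>

lemma browder_path:
  fixes V :: "'a::{real_inner, complete_space} \<Rightarrow> 'a"
  assumes V: "\<And>x y. norm (V x - V y) \<le> norm (x - y)" and fixed: "V z = z"
  obtains v q where "v \<longlonglongrightarrow> q" "V q = q"
    "\<And>n. v n - V (v n) = - (1 / real (Suc n)) *\<^sub>R v n"
    "\<And>x. V x = x \<Longrightarrow> inner q (q - x) \<le> 0"
proof -
  let ?\<epsilon> = "\<lambda>n. 1 / real (Suc n)"
  \<comment> \<open>The path solves \<open>(x - V x) + ?\<epsilon> n *\<^sub>R x = 0\<close>,
    written as the fixed-point equation of a strict contraction.\<close>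
  have "\<exists>x. (1 / (1 + ?\<epsilon> n)) *\<^sub>R V x = x" for n
  proof -
    have "\<exists>!x. (1 / (1 + ?\<epsilon> n)) *\<^sub>R V x = x"
    proof (rule banach_fix_type)
      show "\<forall>x y. dist ((1 / (1 + ?\<epsilon> n)) *\<^sub>R V x) ((1 / (1 + ?\<epsilon> n)) *\<^sub>R V y) \<le> (1 / (1 + ?\<epsilon> n)) * dist x y"
        using V by (simp add: dist_norm divide_right_mono flip: scaleR_diff_right)
    qed (auto simp: field_simps add_nonneg_nonneg)
    then show ?thesis by blast
  qed
  then obtain v where v: "\<And>n. (1 / (1 + ?\<epsilon> n)) *\<^sub>R V (v n) = v n" by metis
  have path: "v n - V (v n) = - ?\<epsilon> n *\<^sub>R v n" for n
  proof -
    have "1 + ?\<epsilon> n > 0" by (simp add: add_pos_pos)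
    then have "V (v n) = (1 + ?\<epsilon> n) *\<^sub>R ((1 / (1 + ?\<epsilon> n)) *\<^sub>R V (v n))" by simp
    then have "V (v n) = (1 + ?\<epsilon> n) *\<^sub>R v n" by (simp only: v)
    then show ?thesis by (simp add: scaleR_add_left)
  qed
  note mono = nonexpansive_displacement_monotone[of V, OF V]
  \<comment> \<open>Monotonicity of the displacement against a fixed point, whose own displacement
    is 0, divided by the positive parameter.\<close>
  have var: "inner (v n) (v n - x) \<le> 0" if "V x = x" for n x
  proof -
    have "?\<epsilon> n * inner (v n) (v n - x) \<le> 0"
      using mono[of "v n" x] that by (simp add: path inner_commute)
    then show ?thesis by (simp add: divide_le_0_iff)
  qed
  have bound: "(norm (v n))\<^sup>2 \<le> (norm z)\<^sup>2" for n
  proof -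
    have "(norm (v n - z))\<^sup>2 \<ge> 0" by simp
    then show ?thesis using var[OF fixed, of n]
      by (simp add: power2_norm_eq_inner inner_simps inner_commute)
  qed
  have close: "(norm (v n - v m))\<^sup>2 \<le> (norm (v n))\<^sup>2 - (norm (v m))\<^sup>2" if "m < n" for m n
  proof -
    define s t D X where "s = ?\<epsilon> m" and "t = ?\<epsilon> n" and "D = (norm (v n - v m))\<^sup>2"
      and "X = (norm (v n))\<^sup>2 - (norm (v m))\<^sup>2"
    have st: "0 < t" "t < s" using that by (auto simp: s_def t_def field_simps)
    \<comment> \<open>Polarisation. Monotonicity makes the left side nonnegative, and
      \<open>s - t \<le> s + t\<close> allows the factor \<open>s - t\<close> to be
      cancelled.\<close>
    have "2 * inner (v n - v m) (s *\<^sub>R v m - t *\<^sub>R v n) = (s - t) * X - (s + t) * D"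
      by (simp add: D_def X_def power2_norm_eq_inner inner_simps inner_commute algebra_simps)
    moreover have "inner (v n - v m) (s *\<^sub>R v m - t *\<^sub>R v n) \<ge> 0"
      using mono[of "v n" "v m"] unfolding path s_def t_def by (simp add: algebra_simps)
    ultimately have le: "(s + t) * D \<le> (s - t) * X" by linarith
    have "D \<ge> 0" by (simp add: D_def)
    have "(s - t) * D \<le> (s + t) * D" using \<open>D \<ge> 0\<close> st by (intro mult_right_mono) auto
    with le st have "(s - t) * D \<le> (s - t) * X" by linarith
    then have "D \<le> X" using st by simp
    then show ?thesis by (simp add: D_def X_def)
  qed
  have inc: "incseq (\<lambda>n. (norm (v n))\<^sup>2)"
  proof (rule incseq_SucI)
    fix n show "(norm (v n))\<^sup>2 \<le> (norm (v (Suc n)))\<^sup>2"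
      using close[of n "Suc n"] zero_le_power2[of "norm (v (Suc n) - v n)"] by linarith
  qed
  obtain L where "(\<lambda>n. (norm (v n))\<^sup>2) \<longlonglongrightarrow> L"
    using incseq_convergent[OF inc, of "(norm z)\<^sup>2"] bound by blast
  then have nC: "Cauchy (\<lambda>n. (norm (v n))\<^sup>2)" using convergent_Cauchy convergent_def by blast
  have "Cauchy v"
  proof (rule metric_CauchyI)
    fix \<epsilon> :: real assume "\<epsilon> > 0"
    then have "\<epsilon>\<^sup>2 > 0" by simp
    from metric_CauchyD[OF nC this] obtain M
      where M: "\<And>m n. m \<ge> M \<Longrightarrow> n \<ge> M \<Longrightarrow> dist ((norm (v m))\<^sup>2) ((norm (v n))\<^sup>2) < \<epsilon>\<^sup>2" by blast
    have "norm (v m - v n) < \<epsilon>" if "m \<ge> M" "n \<ge> M" for m n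
    proof (rule power_less_imp_less_base)
      have "(norm (v m - v n))\<^sup>2 \<le> \<bar>(norm (v m))\<^sup>2 - (norm (v n))\<^sup>2\<bar>"
      proof (cases m n rule: linorder_cases)
        case less
        from close[OF less] show ?thesis unfolding norm_minus_commute[of "v m"] by linarith
      next
        case greater
        from close[OF greater] show ?thesis by linarith
      qed simp
      with M[OF that] show "(norm (v m - v n))\<^sup>2 < \<epsilon>\<^sup>2" by (simp add: dist_real_def)
    qed (use \<open>\<epsilon> > 0\<close> in simp)
    then show "\<exists>M. \<forall>m\<ge>M. \<forall>n\<ge>M. dist (v m) (v n) < \<epsilon>" by (auto simp: dist_norm)
  qed
  then obtain q where q: "v \<longlonglongrightarrow> q" using Cauchy_convergent convergent_def by blast
  have "(\<lambda>n. V (v n)) \<longlonglongrightarrow> V q"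
  proof (rule LIM_zero_cancel, rule Lim_null_comparison)
    show "\<forall>\<^sub>F n in sequentially. norm (V (v n) - V q) \<le> norm (v n - q)" using V by simp
    show "(\<lambda>n. norm (v n - q)) \<longlonglongrightarrow> 0" using q by (intro tendsto_norm_zero LIM_zero)
  qed
  then have "(\<lambda>n. v n - V (v n)) \<longlonglongrightarrow> q - V q" using q by (intro tendsto_intros)
  moreover have "(\<lambda>n. - ?\<epsilon> n *\<^sub>R v n) \<longlonglongrightarrow> - 0 *\<^sub>R q"
    by (intro tendsto_scaleR tendsto_minus q) (fact LIMSEQ_inverse_real_of_nat[unfolded inverse_eq_divide])
  ultimately have "q - V q = - 0 *\<^sub>R q" unfolding path by (rule LIMSEQ_unique)
  then have "V q = q" by simp
  moreover have "inner q (q - x) \<le> 0" if "V x = x" for x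
  proof (rule LIMSEQ_le_const2)
    show "(\<lambda>n. inner (v n) (v n - x)) \<longlonglongrightarrow> inner q (q - x)" by (intro tendsto_intros q)
  qed (use var[OF that] in blast)
  ultimately show thesis using q path that by blast
qed

text \<open>The variational inequality yields \<open>(norm q)\<^sup>2 + (norm (q - x))\<^sup>2 \<le>
  (norm x)\<^sup>2\<close>, so \<open>q\<close> has least norm in \<open>C\<close> and any other
  minimiser coincides with it.\<close>

lemma metric_proj_zero_eqI:
  assumes "q \<in> C" "\<And>x. x \<in> C \<Longrightarrow> inner q (q - x) \<le> 0"
  shows "metric_proj C 0 = q"
proof -
  have exp: "(norm x)\<^sup>2 = (norm q)\<^sup>2 - 2 * inner q (q - x) + (norm (q - x))\<^sup>2" for x
    by (simp add: power2_norm_eq_inner inner_simps inner_commute)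
  have le: "(norm q)\<^sup>2 + (norm (q - x))\<^sup>2 \<le> (norm x)\<^sup>2" if "x \<in> C" for x
    using exp[of x] assms(2)[OF that] by linarith
  show ?thesis
    unfolding metric_proj_def
  proof (rule the_equality)
    show "q \<in> C \<and> (\<forall>x\<in>C. dist 0 q \<le> dist 0 x)"
    proof (intro conjI ballI assms(1))
      fix x assume "x \<in> C"
      from le[OF this] have "(norm q)\<^sup>2 \<le> (norm x)\<^sup>2"
        using zero_le_power2[of "norm (q - x)"] by linarith
      then show "dist 0 q \<le> dist 0 x" by (simp add: power2_le_iff_abs_le)
    qed
    fix p assume p: "p \<in> C \<and> (\<forall>x\<in>C. dist 0 p \<le> dist 0 x)"
    then have "norm p \<le> norm q" using assms(1) by simp
    then have "(norm p)\<^sup>2 \<le> (norm q)\<^sup>2" by (rule power_mono) simp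
    with le[of p] p have "(norm (q - p))\<^sup>2 \<le> 0" by linarith
    then have "norm (q - p) = 0" by simp
    then show "p = q" by simp
  qed
qed

section \<open>Sequences of contractive type\<close>

text \<open>Once \<open>b\<close> is below \<epsilon>, the excess of \<open>a\<close> over
  \<epsilon> is controlled by a product of factors \<open>1 - \<mu> n \<le> exp (- \<mu> n)\<close>,
  which vanishes because the series of weights diverges. Bounding \<open>b\<close> from above alone
  suits inner products of unknown sign.\<close>

lemma contractive_recursion_tendsto_zero:
  fixes a b \<mu> :: "nat \<Rightarrow> real"
  assumes nonneg: "\<And>n. a n \<ge> 0" and \<mu>: "\<And>n. 0 \<le> \<mu> n" "\<And>n. \<mu> n \<le> 1"
    and div: "filterlim (\<lambda>N. \<Sum>n<N. \<mu> n) at_top sequentially"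
    and rec: "\<And>n. a (Suc n) \<le> (1 - \<mu> n) * a n + \<mu> n * b n"
    and b: "\<And>\<epsilon>. \<epsilon> > 0 \<Longrightarrow> \<forall>\<^sub>F n in sequentially. b n \<le> \<epsilon>"
  shows "a \<longlonglongrightarrow> 0"
proof (rule LIMSEQ_I)
  fix r :: real assume "r > 0"
  define \<epsilon> where "\<epsilon> = r / 2"
  have "\<epsilon> > 0" using \<open>r > 0\<close> by (simp add: \<epsilon>_def)
  obtain N where N: "\<And>n. n \<ge> N \<Longrightarrow> b n \<le> \<epsilon>"
    using b[OF \<open>\<epsilon> > 0\<close>] by (auto simp: eventually_sequentially)
  let ?\<Lambda> = "\<lambda>n. \<Sum>k<n. \<mu> k"
  have decay: "a (N + k) \<le> \<epsilon> + exp (?\<Lambda> N - ?\<Lambda> (N + k)) * a N" for k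
  proof (induction k)
    case 0
    then show ?case using \<open>\<epsilon> > 0\<close> by simp
  next
    case (Suc k)
    let ?l = "\<mu> (N + k)" and ?E = "exp (?\<Lambda> N - ?\<Lambda> (N + k)) * a N"
    have E: "?E \<ge> 0" using nonneg by simp
    have "a (N + Suc k) \<le> (1 - ?l) * a (N + k) + ?l * \<epsilon>"
      using rec[of "N + k"] mult_left_mono[OF N[of "N + k"] \<mu>(1)[of "N + k"]] by simp
    also have "\<dots> \<le> (1 - ?l) * (\<epsilon> + ?E) + ?l * \<epsilon>"
      using Suc \<mu>(2)[of "N + k"] by (intro add_right_mono mult_left_mono) auto
    also have "\<dots> = \<epsilon> + (1 - ?l) * ?E" by (simp add: algebra_simps)
    also have "\<dots> \<le> \<epsilon> + exp (- ?l) * ?E"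
      using exp_ge_add_one_self[of "- ?l"] E by (intro add_left_mono mult_right_mono) auto
    also have "exp (- ?l) * ?E = exp (?\<Lambda> N - ?\<Lambda> (N + Suc k)) * a N"
      by (simp add: mult.assoc[symmetric] exp_add[symmetric] algebra_simps)
    finally show ?case .
  qed
  have "filterlim (\<lambda>k. ?\<Lambda> (k + N)) at_top sequentially"
    using div by (rule filterlim_compose) (rule filterlim_add_const_nat_at_top)
  then have "filterlim (\<lambda>k. - ?\<Lambda> N + ?\<Lambda> (k + N)) at_top sequentially"
    by (rule filterlim_tendsto_add_at_top[OF tendsto_const])
  then have "filterlim (\<lambda>k. - (- ?\<Lambda> N + ?\<Lambda> (k + N))) at_bot sequentially"
    by (simp only: filterlim_uminus_at_bot minus_minus)
  then have "(\<lambda>k. exp (- (- ?\<Lambda> N + ?\<Lambda> (k + N))) * a N) \<longlonglongrightarrow> 0 * a N"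
    by (intro tendsto_mult tendsto_const filterlim_compose[OF exp_at_bot])
  then have "\<forall>\<^sub>F k in sequentially. exp (- (- ?\<Lambda> N + ?\<Lambda> (k + N))) * a N < \<epsilon>"
    using \<open>\<epsilon> > 0\<close> by (intro order_tendstoD(2)) auto
  then obtain K where K: "\<And>k. k \<ge> K \<Longrightarrow> exp (?\<Lambda> N - ?\<Lambda> (N + k)) * a N < \<epsilon>"
    by (auto simp: eventually_sequentially add.commute)
  have "norm (a n - 0) < r" if "n \<ge> N + K" for n
  proof -
    from that obtain k where "n = N + k" "k \<ge> K"
      by (metis add_le_cancel_left le_add1 le_trans nat_le_iff_add)
    then show ?thesis using decay[of k] K[of k] nonneg[of n] by (simp add: \<epsilon>_def)
  qed
  then show "\<exists>no. \<forall>n\<ge>no. norm (a n - 0) < r" by blast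
qed

lemma contractive_recursion_summable_tendsto_zero:
  fixes a c \<mu> :: "nat \<Rightarrow> real"
  assumes nonneg: "\<And>n. a n \<ge> 0" and \<mu>: "\<And>n. 0 \<le> \<mu> n" "\<And>n. \<mu> n \<le> 1"
    and div: "filterlim (\<lambda>N. \<Sum>n<N. \<mu> n) at_top sequentially"
    and rec: "\<And>n. a (Suc n) \<le> (1 - \<mu> n) * a n + c n"
    and c: "summable c" "\<And>n. c n \<ge> 0"
  shows "a \<longlonglongrightarrow> 0"
proof -
  \<comment> \<open>Adding the tail of the series to the sequence absorbs the perturbation.\<close>
  define C where "C n = (\<Sum>k. c (k + n))" for n
  have C_nonneg: "C n \<ge> 0" for n
    unfolding C_def using c by (intro suminf_nonneg summable_ignore_initial_segment) auto
  have C_Suc: "C n = c n + C (Suc n)" for n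
    unfolding C_def using suminf_split_head[OF summable_ignore_initial_segment[OF c(1), of n]] by simp
  have C_lim: "C \<longlonglongrightarrow> 0" unfolding C_def using suminf_exist_split2[OF c(1)] .
  have "(\<lambda>n. a n + C n) \<longlonglongrightarrow> 0"
  proof (rule contractive_recursion_tendsto_zero[where b = C and \<mu> = \<mu>])
    show "a (Suc n) + C (Suc n) \<le> (1 - \<mu> n) * (a n + C n) + \<mu> n * C n" for n
      using rec[of n] C_Suc[of n] by (simp add: algebra_simps)
    show "\<forall>\<^sub>F n in sequentially. C n \<le> \<epsilon>" if "\<epsilon> > 0" for \<epsilon>
      using order_tendstoD(2)[OF C_lim that] by (rule eventually_mono) simp
  qed (use nonneg C_nonneg \<mu> div in auto)
  from tendsto_diff[OF this C_lim] show ?thesis by simp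
qed

section \<open>The regularised iteration\<close>

text \<open>The factor \<open>e n\<close> pulls the iterates towards 0 and so selects the common
  zero of least norm. The bounds \<sigma> and \<tau> keep \<theta> away from both ends of the
  interval from 0 to \<open>2 * \<kappa>1\<close>, on which a step along \<open>S1\<close> decreases
  distances.\<close>

lemma tikhonov_iteration_tendsto:
  fixes S1 S2 :: "'a::{real_inner, complete_space} \<Rightarrow> 'a" and y :: "nat \<Rightarrow> 'a"
    and \<theta> e :: "nat \<Rightarrow> real"
  defines "F \<equiv> {x. S1 x = 0 \<and> S2 x = 0}"
  assumes S1: "cocoercive \<kappa>1 S1" "\<kappa>1 > 1/2" and S2: "cocoercive \<kappa>2 S2" "\<kappa>2 > 1/2"
    and F: "F \<noteq> {}"
    and y: "\<And>n. y (Suc n) = (let x = e n *\<^sub>R y n; u = x - \<theta> n *\<^sub>R S1 x in u - S2 u)"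
    and e: "\<And>n. 0 \<le> e n" "\<And>n. e n \<le> 1" "e \<longlonglongrightarrow> 1"
      "filterlim (\<lambda>N. \<Sum>n<N. 1 - e n) at_top sequentially" "summable (\<lambda>n. \<bar>e (Suc n) - e n\<bar>)"
    and \<theta>: "0 < \<sigma>" "\<tau> < 1" "\<And>n. 2 * \<kappa>1 * \<sigma> \<le> \<theta> n" "\<And>n. \<theta> n \<le> 2 * \<kappa>1 * \<tau>"
      "summable (\<lambda>n. \<bar>\<theta> (Suc n) - \<theta> n\<bar>)"
  shows "y \<longlonglongrightarrow> metric_proj F 0"
proof -
  have \<kappa>: "\<kappa>1 > 0" "\<kappa>2 > 0" using S1 S2 by auto
  have "2 * \<kappa>1 * \<sigma> > 0" using \<kappa> \<theta>(1) by simp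
  then have \<theta>_pos: "\<theta> n > 0" for n using \<theta>(3)[of n] by linarith
  have "2 * \<kappa>1 * \<tau> < 2 * \<kappa>1" using \<kappa> \<theta>(2) by simp
  then have \<theta>_less: "\<theta> n < 2 * \<kappa>1" for n using \<theta>(4)[of n] by linarith

  \<comment> \<open>An averaged map and its path to the minimum-norm zero\<close>
  define V where "V x = x - (1/2) *\<^sub>R (S1 x + S2 x)" for x
  have V_fixed: "V x = x \<longleftrightarrow> x \<in> F" for x
  proof -
    obtain z where "S1 z = 0" "S2 z = 0" using F by (auto simp: F_def)
    then have "S1 x + S2 x = 0 \<longleftrightarrow> x \<in> F"
      unfolding F_def using cocoercive_sum_zero[OF S1(1) S2(1) \<kappa>, of z x] by auto
    then show ?thesis by (simp add: V_def)
  qed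
  \<comment> \<open>\<open>V\<close> is the mean of \<open>I - S1\<close> and \<open>I - S2\<close>,
    each nonexpansive because its cocoercivity constant exceeds 1/2.\<close>
  have V: "norm (V x - V w) \<le> norm (x - w)" for x w
  proof -
    have half: "V x = (1/2) *\<^sub>R ((x - 1 *\<^sub>R S1 x) + (x - 1 *\<^sub>R S2 x))" for x
    proof -
      have "(x - 1 *\<^sub>R S1 x) + (x - 1 *\<^sub>R S2 x) = (x + x) - (S1 x + S2 x)" by simp
      then show ?thesis by (simp only: V_def scaleR_diff_right scaleR_half_double)
    qed
    have "V x - V w = (1/2) *\<^sub>R (((x - 1 *\<^sub>R S1 x) - (w - 1 *\<^sub>R S1 w))
        + ((x - 1 *\<^sub>R S2 x) - (w - 1 *\<^sub>R S2 w)))"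
      unfolding half scaleR_diff_right[symmetric] by (simp add: algebra_simps)
    also have "norm \<dots> \<le> (1/2) * (norm (x - w) + norm (x - w))"
      unfolding norm_scaleR
      using cocoercive_step_nonexpansive[OF S1(1), of 1 x w] cocoercive_step_nonexpansive[OF S2(1), of 1 x w] S1(2) S2(2)
      by (intro mult_mono norm_triangle_le add_mono) auto
    finally show ?thesis by simp
  qed
  obtain z0 where "V z0 = z0" using F V_fixed by blast
  from browder_path[of V, OF V this] obtain v q where v: "v \<longlonglongrightarrow> q" and "V q = q"
    and path: "\<And>n. v n - V (v n) = - (1 / real (Suc n)) *\<^sub>R v n"
    and var: "\<And>x. V x = x \<Longrightarrow> inner q (q - x) \<le> 0" by blast
  then have proj: "metric_proj F 0 = q" by (intro metric_proj_zero_eqI) (auto simp: V_fixed)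
  have q: "S1 q = 0" "S2 q = 0" using \<open>V q = q\<close> by (auto simp: V_fixed F_def)

  \<comment> \<open>Boundedness of the iterates\<close>
  define x where "x n = e n *\<^sub>R y n" for n
  define u where "u n = x n - \<theta> n *\<^sub>R S1 (x n)" for n
  have y_Suc: "y (Suc n) = u n - S2 (u n)" for n
    using y[of n] by (simp add: Let_def x_def u_def)
  have S2_nonexp: "norm ((a - S2 a) - (b - S2 b)) \<le> norm (a - b)" for a b
    using cocoercive_step_nonexpansive[OF S2(1), of 1 a b] S2(2) by simp
  have S1_nonexp: "norm ((a - \<theta> n *\<^sub>R S1 a) - (b - \<theta> n *\<^sub>R S1 b)) \<le> norm (a - b)" for a b n
    using cocoercive_step_nonexpansive[OF S1(1), of "\<theta> n" a b] \<theta>_pos[of n] \<theta>_less[of n] by simp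
  have u_q: "norm (u n - q) \<le> norm (x n - q)" for n
    using S1_nonexp[of "x n" n q] q by (simp add: u_def)
  have y_q: "norm (y (Suc n) - q) \<le> norm (u n - q)" for n
    using S2_nonexp[of "u n" q] q by (simp add: y_Suc)
  have x_split: "x n - q = e n *\<^sub>R (y n - q) - (1 - e n) *\<^sub>R q" for n
    by (simp add: x_def algebra_simps)
  \<comment> \<open>By \<open>x_split\<close>, the distance of \<open>x n\<close> to
    \<open>q\<close> is at most a convex combination of that of \<open>y n\<close> and
    \<open>norm q\<close>; the maximum of the initial distance and \<open>norm q\<close> is thus
    preserved.\<close>
  define K where "K = max (norm (y 0 - q)) (norm q)"
  have x_q_le: "norm (x n - q) \<le> e n * norm (y n - q) + (1 - e n) * norm q" for n
    unfolding x_split using norm_triangle_ineq4[of "e n *\<^sub>R (y n - q)" "(1 - e n) *\<^sub>R q"] e(1,2)[of n] by simp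
  have convex_K: "e n * a + (1 - e n) * norm q \<le> K" if "a \<le> K" for a n
  proof -
    have "e n * a + (1 - e n) * norm q \<le> e n * K + (1 - e n) * K"
      using that e(1,2)[of n] by (intro add_mono mult_left_mono) (auto simp: K_def)
    then show ?thesis by (simp add: algebra_simps)
  qed
  have y_K: "norm (y n - q) \<le> K" for n
  proof (induction n)
    case (Suc n)
    then show ?case using y_q[of n] u_q[of n] x_q_le[of n] convex_K[OF Suc, of n] by linarith
  qed (simp add: K_def)
  have x_K: "norm (x n - q) \<le> K" for n
    using x_q_le[of n] convex_K[OF y_K, of n n] by linarith
  have y_norm: "norm (y n) \<le> 2 * K" for n
    using norm_triangle_ineq[of "y n - q" q] y_K[of n] by (simp add: K_def)
  have S1_K: "norm (S1 (x n)) \<le> K / \<kappa>1" for n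
  proof -
    have "norm (S1 (x n)) \<le> norm (x n - q) / \<kappa>1"
      using cocoercive_lipschitz[OF S1(1) \<kappa>(1), of "x n" q] q by simp
    also have "\<dots> \<le> K / \<kappa>1" using x_K \<kappa> by (intro divide_right_mono) auto
    finally show ?thesis .
  qed
  have K0: "K \<ge> 0" using y_K[of 0] norm_ge_zero order_trans by blast

  \<comment> \<open>Vanishing increments\<close>
  have increments: "(\<lambda>n. norm (y (Suc n) - y n)) \<longlonglongrightarrow> 0"
  proof (rule contractive_recursion_summable_tendsto_zero)
    fix n
    have "norm (x (Suc n) - x n) \<le> e (Suc n) * norm (y (Suc n) - y n) + \<bar>e (Suc n) - e n\<bar> * (2 * K)"
    proof -
      have "x (Suc n) - x n = e (Suc n) *\<^sub>R (y (Suc n) - y n) + (e (Suc n) - e n) *\<^sub>R y n"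
        by (simp add: x_def algebra_simps)
      also have "norm \<dots> \<le> e (Suc n) * norm (y (Suc n) - y n) + \<bar>e (Suc n) - e n\<bar> * (2 * K)"
        using e(1) y_norm[of n] by (intro norm_triangle_le add_mono) (auto intro: mult_left_mono)
      finally show ?thesis .
    qed
    moreover have "norm (u (Suc n) - u n) \<le> norm (x (Suc n) - x n) + \<bar>\<theta> (Suc n) - \<theta> n\<bar> * (K / \<kappa>1)"
    proof -
      \<comment> \<open>Both points are moved with the same parameter
        \<open>\<theta> (Suc n)\<close>, which isolates the change of \<theta> in a single summable
        term.\<close>
      have "u (Suc n) - u n = ((x (Suc n) - \<theta> (Suc n) *\<^sub>R S1 (x (Suc n))) - (x n - \<theta> (Suc n) *\<^sub>R S1 (x n)))
          - (\<theta> (Suc n) - \<theta> n) *\<^sub>R S1 (x n)"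
        by (simp add: u_def algebra_simps)
      also have "norm \<dots> \<le> norm ((x (Suc n) - \<theta> (Suc n) *\<^sub>R S1 (x (Suc n))) - (x n - \<theta> (Suc n) *\<^sub>R S1 (x n)))
          + norm ((\<theta> (Suc n) - \<theta> n) *\<^sub>R S1 (x n))"
        by (rule norm_triangle_ineq4)
      also have "\<dots> \<le> norm (x (Suc n) - x n) + \<bar>\<theta> (Suc n) - \<theta> n\<bar> * (K / \<kappa>1)"
        unfolding norm_scaleR real_norm_def by (intro add_mono S1_nonexp mult_left_mono S1_K abs_ge_zero)
      finally show ?thesis .
    qed
    moreover have "norm (y (Suc (Suc n)) - y (Suc n)) \<le> norm (u (Suc n) - u n)"
      using S2_nonexp unfolding y_Suc by blast
    ultimately show "norm (y (Suc (Suc n)) - y (Suc n)) \<le> (1 - (1 - e (Suc n))) * norm (y (Suc n) - y n)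
        + (\<bar>e (Suc n) - e n\<bar> * (2 * K) + \<bar>\<theta> (Suc n) - \<theta> n\<bar> * (K / \<kappa>1))"
      by simp
  next
    \<comment> \<open>The contraction factor is \<open>e (Suc n)\<close>, so divergence is
      transferred to the series without its first term.\<close>
    have "filterlim (\<lambda>N. \<Sum>n<Suc N. 1 - e n) at_top sequentially"
      using e(4) by (rule filterlim_compose) (rule filterlim_Suc)
    then have "filterlim (\<lambda>N. - (1 - e 0) + (\<Sum>n<Suc N. 1 - e n)) at_top sequentially"
      by (rule filterlim_tendsto_add_at_top[OF tendsto_const])
    then show "filterlim (\<lambda>N. \<Sum>n<N. 1 - e (Suc n)) at_top sequentially"
      by (simp only: sum.lessThan_Suc_shift) (simp add: o_def)
    show "summable (\<lambda>n. \<bar>e (Suc n) - e n\<bar> * (2 * K) + \<bar>\<theta> (Suc n) - \<theta> n\<bar> * (K / \<kappa>1))"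
      using e(5) \<theta>(5) by (intro summable_add summable_mult2)
  qed (use e K0 \<kappa> in auto)
  \<comment> \<open>The difference is the increment of \<open>y\<close> plus
    \<open>(1 - e n) *\<^sub>R y n\<close>, a vanishing factor times a bounded sequence.\<close>
  have y_x: "(\<lambda>n. y (Suc n) - x n) \<longlonglongrightarrow> 0"
  proof -
    have "(\<lambda>n. (1 - e n) *\<^sub>R y n) \<longlonglongrightarrow> 0"
    proof (rule Lim_null_comparison)
      show "\<forall>\<^sub>F n in sequentially. norm ((1 - e n) *\<^sub>R y n) \<le> (1 - e n) * (2 * K)"
        using e(2) y_norm by (auto intro!: always_eventually mult_left_mono)
      have "(\<lambda>n. (1 - e n) * (2 * K)) \<longlonglongrightarrow> (1 - 1) * (2 * K)" by (intro tendsto_intros e)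
      then show "(\<lambda>n. (1 - e n) * (2 * K)) \<longlonglongrightarrow> 0" by simp
    qed
    from tendsto_add[OF tendsto_norm_zero_cancel[OF increments] this] show ?thesis
      by (simp add: x_def algebra_simps)
  qed

  \<comment> \<open>The squared distance to \<open>q\<close> changes by a vanishing amount, and each
    of the two steps decreases it by a multiple of the squared residual.\<close>
  define c1 c2 where "c1 = (2 * \<kappa>1 * \<sigma>) * (2 * \<kappa>1 * (1 - \<tau>))" and "c2 = 2 * \<kappa>2 - 1"
  have c: "c1 > 0" "c2 > 0" using \<kappa> \<theta>(1,2) S2(2) by (auto simp: c1_def c2_def)
  have descent: "c1 * (norm (S1 (x n)))\<^sup>2 + c2 * (norm (S2 (u n)))\<^sup>2 \<le> 2 * K * norm (y (Suc n) - x n)" for n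
  proof -
    have "(norm (u n - q))\<^sup>2 \<le> (norm (x n - q))\<^sup>2 - \<theta> n * (2 * \<kappa>1 - \<theta> n) * (norm (S1 (x n)))\<^sup>2"
      using cocoercive_step[OF S1(1), of "\<theta> n" "x n" q] \<theta>_pos[of n] q by (simp add: u_def)
    moreover have "(norm (y (Suc n) - q))\<^sup>2 \<le> (norm (u n - q))\<^sup>2 - c2 * (norm (S2 (u n)))\<^sup>2"
      using cocoercive_step[OF S2(1), of 1 "u n" q] q by (simp add: y_Suc c2_def)
    moreover have "c1 * (norm (S1 (x n)))\<^sup>2 \<le> \<theta> n * (2 * \<kappa>1 - \<theta> n) * (norm (S1 (x n)))\<^sup>2"
      unfolding c1_def using \<theta>(3,4)[of n] \<theta>_pos[of n] \<theta>(1,2) \<kappa>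
      by (intro mult_right_mono mult_mono) (auto simp: algebra_simps)
    moreover have "(norm (x n - q))\<^sup>2 - (norm (y (Suc n) - q))\<^sup>2 \<le> 2 * K * norm (y (Suc n) - x n)"
    proof -
      have "(norm (x n - q))\<^sup>2 - (norm (y (Suc n) - q))\<^sup>2
          = (norm (x n - q) + norm (y (Suc n) - q)) * (norm (x n - q) - norm (y (Suc n) - q))"
        by (simp add: power2_eq_square algebra_simps)
      also have "\<dots> \<le> (norm (x n - q) + norm (y (Suc n) - q)) * norm (y (Suc n) - x n)"
        using norm_triangle_ineq2[of "x n - q" "y (Suc n) - q"]
        by (intro mult_left_mono) (auto simp: norm_minus_commute)
      also have "\<dots> \<le> 2 * K * norm (y (Suc n) - x n)"
        using x_K[of n] y_K[of "Suc n"] by (intro mult_right_mono) auto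
      finally show ?thesis .
    qed
    ultimately show ?thesis by linarith
  qed
  have rhs: "(\<lambda>n. 2 * K * norm (y (Suc n) - x n) / c) \<longlonglongrightarrow> 0" for c
    using tendsto_divide_zero[OF tendsto_mult_right_zero[OF tendsto_norm_zero[OF y_x]]] by blast
  have sq_null: "w \<longlonglongrightarrow> 0" if "\<And>n. c * (norm (w n))\<^sup>2 \<le> 2 * K * norm (y (Suc n) - x n)" "c > 0"
    for w :: "nat \<Rightarrow> 'a" and c
  proof -
    have "(\<lambda>n. (norm (w n))\<^sup>2) \<longlonglongrightarrow> 0"
      by (rule Lim_null_comparison[OF _ rhs[of c]])
        (use that in \<open>auto simp: field_simps intro!: always_eventually\<close>)
    from tendsto_real_sqrt[OF this] show ?thesis by (simp add: tendsto_norm_zero_iff)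
  qed
  have S1_x: "(\<lambda>n. S1 (x n)) \<longlonglongrightarrow> 0"
  proof (rule sq_null[OF _ c(1)])
    show "c1 * (norm (S1 (x n)))\<^sup>2 \<le> 2 * K * norm (y (Suc n) - x n)" for n
      using descent[of n] mult_nonneg_nonneg[OF less_imp_le[OF c(2)] zero_le_power2[of "norm (S2 (u n))"]] by linarith
  qed
  have S2_u: "(\<lambda>n. S2 (u n)) \<longlonglongrightarrow> 0"
  proof (rule sq_null[OF _ c(2)])
    show "c2 * (norm (S2 (u n)))\<^sup>2 \<le> 2 * K * norm (y (Suc n) - x n)" for n
      using descent[of n] mult_nonneg_nonneg[OF less_imp_le[OF c(1)] zero_le_power2[of "norm (S1 (x n))"]] by linarith
  qed
  \<comment> \<open>The descent controls \<open>S2\<close> at \<open>u n\<close>. Since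
    \<open>x n - u n\<close> is \<open>\<theta> n *\<^sub>R S1 (x n)\<close>, Lipschitz continuity
    carries this over to \<open>x n\<close>.\<close>
  have "(\<lambda>n. S2 (x n) - S2 (u n)) \<longlonglongrightarrow> 0"
  proof (rule Lim_null_comparison)
    have "norm (S2 (x n) - S2 (u n)) \<le> 2 * \<kappa>1 / \<kappa>2 * norm (S1 (x n))" for n
    proof -
      have "norm (S2 (x n) - S2 (u n)) \<le> norm (x n - u n) / \<kappa>2"
        by (rule cocoercive_lipschitz[OF S2(1) \<kappa>(2)])
      also have "norm (x n - u n) = \<theta> n * norm (S1 (x n))" using \<theta>_pos[of n] by (simp add: u_def)
      also have "\<dots> / \<kappa>2 \<le> (2 * \<kappa>1) * norm (S1 (x n)) / \<kappa>2"
        using \<theta>_less[of n] \<kappa> by (intro divide_right_mono mult_right_mono) auto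
      finally show ?thesis by simp
    qed
    then show "\<forall>\<^sub>F n in sequentially. norm (S2 (x n) - S2 (u n)) \<le> 2 * \<kappa>1 / \<kappa>2 * norm (S1 (x n))"
      by simp
    show "(\<lambda>n. 2 * \<kappa>1 / \<kappa>2 * norm (S1 (x n))) \<longlonglongrightarrow> 0"
      by (intro tendsto_mult_right_zero tendsto_norm_zero S1_x)
  qed
  from tendsto_add[OF this S2_u] have S2_x: "(\<lambda>n. S2 (x n)) \<longlonglongrightarrow> 0" by simp
  have V_x: "(\<lambda>n. norm (x n - V (x n))) \<longlonglongrightarrow> 0"
    using tendsto_norm[OF tendsto_scaleR[OF tendsto_const tendsto_add[OF S1_x S2_x], of "1/2"]]
    by (simp add: V_def)

  \<comment> \<open>Monotonicity of \<open>I - V\<close> between \<open>x n\<close> and a point of Browder's path replaces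
    the usual argument with weak cluster points.\<close>
  have limsup: "\<forall>\<^sub>F n in sequentially. - 2 * inner q (x n - q) \<le> \<epsilon>" if "\<epsilon> > 0" for \<epsilon>
  proof -
    \<comment> \<open>\<open>B\<close> dominates both \<open>norm (x n - v k)\<close> and
      \<open>norm q\<close>. Replacing \<open>v k\<close> by \<open>q\<close> then makes two errors
      of at most \<epsilon>/8 each.\<close>
    define B where "B = K + norm q + 1"
    have "B > 0" using K0 by (simp add: B_def add_nonneg_pos)
    have "\<forall>\<^sub>F k in sequentially. dist (v k) q < min 1 (\<epsilon> / (8 * B))"
      using \<open>\<epsilon> > 0\<close> \<open>B > 0\<close> by (intro tendstoD[OF v]) simp
    then obtain k where "dist (v k) q < min 1 (\<epsilon> / (8 * B))"
      by (auto simp: eventually_sequentially)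
    then have k1: "norm (v k - q) < 1" and k2: "norm (v k - q) < \<epsilon> / (8 * B)" by (auto simp: dist_norm)
    have x_v: "norm (x n - v k) \<le> B" for n
    proof -
      have "norm (x n - v k) \<le> norm (x n - q) + norm (v k - q)"
        using norm_triangle_ineq4[of "x n - q" "v k - q"] by simp
      then show ?thesis using x_K[of n] k1 norm_ge_zero[of q] unfolding B_def by linarith
    qed
    \<comment> \<open>The path equation at \<open>v k\<close> carries the factor
      \<open>1 / real (Suc k)\<close>, which the tolerance compensates; \<open>k\<close> is fixed
      before \<open>n\<close> grows.\<close>
    have "\<forall>\<^sub>F n in sequentially. norm (x n - V (x n)) < \<epsilon> / (4 * (real (Suc k) * B))"
      using order_tendstoD(2)[OF V_x] \<open>\<epsilon> > 0\<close> \<open>B > 0\<close> by simp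
    then show ?thesis
    proof (rule eventually_mono)
      fix n assume n: "norm (x n - V (x n)) < \<epsilon> / (4 * (real (Suc k) * B))"
      have "0 \<le> inner (x n - v k) ((x n - V (x n)) - (v k - V (v k)))"
        by (rule nonexpansive_displacement_monotone) (rule V)
      then have "- inner (v k) (x n - v k) / real (Suc k) \<le> inner (x n - v k) (x n - V (x n))"
        unfolding path scaleR_minus_left diff_minus_eq_add inner_add_right inner_scaleR_right
          inner_commute[of "x n - v k" "v k"] by (simp del: of_nat_Suc)
      also have "\<dots> \<le> norm (x n - v k) * norm (x n - V (x n))" by (rule norm_cauchy_schwarz)
      also have "\<dots> \<le> B * (\<epsilon> / (4 * (real (Suc k) * B)))"
        using x_v[of n] n \<open>B > 0\<close> by (intro mult_mono) auto
      also have "\<dots> = \<epsilon> / 4 / real (Suc k)" using \<open>B > 0\<close> by simp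
      finally have 1: "- inner (v k) (x n - v k) \<le> \<epsilon> / 4"
        unfolding divide_le_cancel by simp
      have "inner (v k) (x n - v k) - inner q (x n - q) = inner (v k - q) (x n - v k) - inner q (v k - q)"
        by (simp add: inner_simps)
      also have "\<dots> \<le> norm (v k - q) * norm (x n - v k) + norm q * norm (v k - q)"
        using norm_cauchy_schwarz[of "v k - q" "x n - v k"] Cauchy_Schwarz_ineq2[of q "v k - q"] by linarith
      also have "\<dots> \<le> norm (v k - q) * B + B * norm (v k - q)"
        using x_v[of n] K0 by (intro add_mono mult_left_mono mult_right_mono) (auto simp: B_def)
      also have "\<dots> \<le> \<epsilon> / 4" using k2 \<open>B > 0\<close> by (simp add: field_simps)
      finally show "- 2 * inner q (x n - q) \<le> \<epsilon>" using 1 by simp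
    qed
  qed

  \<comment> \<open>Strong convergence to the minimum-norm zero\<close>
  have "(\<lambda>n. (norm (y n - q))\<^sup>2) \<longlonglongrightarrow> 0"
  proof (rule contractive_recursion_tendsto_zero[OF _ _ _ e(4) _ limsup])
    fix n
    have "(norm (y (Suc n) - q))\<^sup>2 \<le> (norm (x n - q))\<^sup>2"
      using y_q[of n] u_q[of n] by (intro power_mono) auto
    also have "\<dots> \<le> e n * (norm (y n - q))\<^sup>2 + (1 - e n) * (- 2 * inner q (x n - q))"
    proof -
      \<comment> \<open>Only one factor of \<open>inner ?d ?d\<close> is split by
        \<open>x_split\<close>; the inequality for \<open>2 * inner ?w ?d\<close> returns half of
        \<open>(norm ?d)\<^sup>2\<close>, which is moved to the left.\<close>
      let ?d = "x n - q" and ?w = "e n *\<^sub>R (y n - q)"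
      have "(norm ?d)\<^sup>2 = inner ?w ?d - (1 - e n) * inner q ?d"
        unfolding power2_norm_eq_inner by (subst (1) x_split) (simp add: inner_diff_left)
      moreover have "2 * inner a b \<le> (norm a)\<^sup>2 + (norm b)\<^sup>2" for a b :: 'a
        using zero_le_power2[of "norm (a - b)"] by (simp add: power2_norm_eq_inner inner_diff inner_commute)
      note this[of ?w ?d]
      moreover have "(norm ?w)\<^sup>2 \<le> e n * (norm (y n - q))\<^sup>2"
      proof -
        have "e n * e n \<le> e n * 1" using e(1,2)[of n] by (intro mult_left_mono)
        then show ?thesis by (simp add: power_mult_distrib power2_eq_square[of "e n"] mult_right_mono)
      qed
      ultimately show ?thesis by (simp add: algebra_simps)
    qed
    finally show "(norm (y (Suc n) - q))\<^sup>2
        \<le> (1 - (1 - e n)) * (norm (y n - q))\<^sup>2 + (1 - e n) * (- 2 * inner q (x n - q))" by simp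
  qed (use e in auto)
  from tendsto_real_sqrt[OF this] have "(\<lambda>n. y n - q) \<longlonglongrightarrow> 0" by (simp add: tendsto_norm_zero_iff)
  then show ?thesis by (simp add: proj LIM_zero_iff)
qed

theorem theorem4p1:
  fixes A1 A2 :: "'a::{real_inner, complete_space} \<Rightarrow> 'a set"
    and B1 B2 :: "'a \<Rightarrow> 'a"
    and \<alpha>1 \<alpha>2 \<gamma>1 \<gamma>2 :: real
    and y :: "nat \<Rightarrow> 'a"
    and \<theta> e :: "nat \<Rightarrow> real"
    and \<Theta>lo \<Theta>up :: real
  assumes "maximally_monotone A1" and "maximally_monotone A2"
    and "\<alpha>1 > 0" and "\<alpha>2 > 0"
    and "cocoercive \<alpha>1 B1" and "cocoercive \<alpha>2 B2"
    and "Zer (op_add A1 (op_single B1)) \<inter> Zer (op_add A2 (op_single B2)) \<noteq> {}"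
    and "\<gamma>1 \<in> {0<..<2 * \<alpha>1}" and "\<gamma>2 \<in> {0<..<2 * \<alpha>2}"
    and "\<And>n. n \<ge> 1 \<Longrightarrow>
           y (n + 1) =
             (resolvent (op_scale \<gamma>2 A2) \<circ> (\<lambda>x. x - \<gamma>2 *\<^sub>R B2 x))
               ((1 - \<theta> n) *\<^sub>R (e n *\<^sub>R y n)
                + \<theta> n *\<^sub>R resolvent (op_scale \<gamma>1 A1) (e n *\<^sub>R y n - \<gamma>1 *\<^sub>R B1 (e n *\<^sub>R y n)))"
    and "\<And>n. n \<ge> 1 \<Longrightarrow> 0 < e n \<and> e n < 1"
    and "e \<longlonglongrightarrow> 1"
    and "filterlim (\<lambda>N. \<Sum>n=1..N. 1 - e n) at_top sequentially"
    and "summable (\<lambda>k. \<bar>e (k + 2) - e (k + 1)\<bar>)"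
    and "0 < \<Theta>lo" and "\<Theta>up < 1"
    and "\<And>n. n \<ge> 1 \<Longrightarrow>
           \<Theta>lo \<le> 2 * \<alpha>1 / (4 * \<alpha>1 - \<gamma>1) * \<theta> n \<and> 2 * \<alpha>1 / (4 * \<alpha>1 - \<gamma>1) * \<theta> n \<le> \<Theta>up"
    and "summable (\<lambda>k. \<bar>\<theta> (k + 2) - \<theta> (k + 1)\<bar>)"
  shows "y \<longlonglongrightarrow>
           metric_proj (Zer (op_add A1 (op_single B1)) \<inter> Zer (op_add A2 (op_single B2))) 0"
proof -
  let ?C = "Zer (op_add A1 (op_single B1)) \<inter> Zer (op_add A2 (op_single B2))"
  define S1 S2 where "S1 x = x - forward_backward \<gamma>1 A1 B1 x"
    and "S2 x = x - forward_backward \<gamma>2 A2 B2 x" for x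
  define \<kappa>1 \<kappa>2 where "\<kappa>1 = 1 - \<gamma>1 / (4 * \<alpha>1)" and "\<kappa>2 = 1 - \<gamma>2 / (4 * \<alpha>2)"
  have \<gamma>: "\<gamma>1 > 0" "\<gamma>2 > 0" "\<gamma>1 < 2 * \<alpha>1" "\<gamma>2 < 2 * \<alpha>2" using assms(8,9) by auto
  have \<kappa>: "\<kappa>1 > 1/2" "\<kappa>2 > 1/2" using \<gamma> assms(3,4) by (auto simp: \<kappa>1_def \<kappa>2_def field_simps)
  have zeros: "{x. S1 x = 0 \<and> S2 x = 0} = ?C"
  proof -
    have "S1 x = 0 \<longleftrightarrow> forward_backward \<gamma>1 A1 B1 x = x" "S2 x = 0 \<longleftrightarrow> forward_backward \<gamma>2 A2 B2 x = x" for x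
      unfolding S1_def S2_def by auto
    then show ?thesis
      unfolding forward_backward_fixed_iff[OF assms(1) \<gamma>(1)] forward_backward_fixed_iff[OF assms(2) \<gamma>(2)]
      by blast
  qed
  \<comment> \<open>\<open>2 * \<kappa>1\<close> equals
    \<open>(4 * \<alpha>1 - \<gamma>1) / (2 * \<alpha>1)\<close>, so the assumed bounds are bounds
    on \<open>\<theta> n / (2 * \<kappa>1)\<close>.\<close>
  have \<theta>: "2 * \<kappa>1 * \<Theta>lo \<le> \<theta> (Suc n)" "\<theta> (Suc n) \<le> 2 * \<kappa>1 * \<Theta>up" for n
  proof -
    have "2 * \<alpha>1 / (4 * \<alpha>1 - \<gamma>1) * \<theta> (Suc n) = \<theta> (Suc n) / (2 * \<kappa>1)"
      using \<gamma> assms(3) by (simp add: \<kappa>1_def field_simps)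
    with assms(17)[of "Suc n"] have "\<Theta>lo \<le> \<theta> (Suc n) / (2 * \<kappa>1)" "\<theta> (Suc n) / (2 * \<kappa>1) \<le> \<Theta>up"
      by auto
    with \<kappa>(1) show "2 * \<kappa>1 * \<Theta>lo \<le> \<theta> (Suc n)" "\<theta> (Suc n) \<le> 2 * \<kappa>1 * \<Theta>up"
      by (simp_all add: field_simps)
  qed
  \<comment> \<open>The hypotheses say nothing about index 0, so the general result is applied to
    the sequences shifted by one.\<close>
  have "(\<lambda>n. y (Suc n)) \<longlonglongrightarrow> metric_proj {x. S1 x = 0 \<and> S2 x = 0} 0"
  proof (rule tikhonov_iteration_tendsto[OF _ \<kappa>(1) _ \<kappa>(2)])
    show "cocoercive \<kappa>1 S1" "cocoercive \<kappa>2 S2"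
      unfolding \<kappa>1_def \<kappa>2_def S1_def S2_def
      using forward_backward_cocoercive assms \<gamma> by blast+
    show "{x. S1 x = 0 \<and> S2 x = 0} \<noteq> {}" using assms(7) by (simp add: zeros)
    \<comment> \<open>The relaxed average of \<open>x\<close> and its forward-backward image is
      \<open>x - \<theta> (Suc n) *\<^sub>R S1 x\<close>.\<close>
    show "y (Suc (Suc n)) = (let x = e (Suc n) *\<^sub>R y (Suc n); u = x - \<theta> (Suc n) *\<^sub>R S1 x in u - S2 u)" for n
      using assms(10)[of "Suc n"]
      by (simp add: S1_def S2_def forward_backward_def Let_def algebra_simps)
    show "(\<lambda>n. e (Suc n)) \<longlonglongrightarrow> 1" using assms(12) by (rule LIMSEQ_Suc)
    show "filterlim (\<lambda>N. \<Sum>n<N. 1 - e (Suc n)) at_top sequentially"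
      using assms(13) by (simp add: sum.atLeast1_atMost_eq)
  qed (use assms(11,14-16,18) \<theta> in \<open>auto simp: less_imp_le\<close>)
  then show ?thesis unfolding zeros by (simp only: filterlim_sequentially_Suc)
qed

end
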